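(* Let $p \geq 4$ be an even integer and let $D$ be an oriented graph of order $n \geq p + 2$. Then $$\mathrm{inv}^{= p}(D) \leq \frac{|A(D)|}{p-1} + 2p^2 n.$$
   Context: For an oriented graph $D$ and $X\subseteq V(D)$, the inversion of $X$ reverses the orientation of every arc with both endpoints in $X$. A $(=p)$-inversion is the inversion of a set of exactly $p$ vertices. $\mathrm{inv}^{=p}(D)$ is the minimum number of $(=p)$-inversions whose successive application makes $D$ acyclic ($+\infty$ if impossible). $A(D)$ is the arc set of $D$. *)

theory Defs
  imports
    "Graph_Theory.Graph_Theory"
    "HOL-Library.Extended_Nat"
    "HOL-Library.Extended_Real"
begin

locale oriented_graph = pair_digraph +
  assumes no_digons: "(u, v) \<in> parcs G \<Longrightarrow> (v, u) \<notin> parcs G"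

definition inversion :: "'a set \<Rightarrow> 'a pair_pre_digraph \<Rightarrow> 'a pair_pre_digraph" where
  "inversion X D = D\<lparr>parcs :=
     {(u, v). (u, v) \<in> parcs D \<and> \<not> (u \<in> X \<and> v \<in> X)} \<union>
     {(v, u) | u v. (u, v) \<in> parcs D \<and> u \<in> X \<and> v \<in> X}\<rparr>"

definition acyclic_digraph :: "'a pair_pre_digraph \<Rightarrow> bool" where
  "acyclic_digraph D \<longleftrightarrow> \<not> (\<exists>c. pre_digraph.cycle (with_proj D) c)"

text \<open>The infimum of the empty set in \<^typ>\<open>enat\<close> is \<open>\<infinity>\<close>, and that of a
  nonempty set is its minimum.\<close>

definition inv_eq :: "nat \<Rightarrow> 'a pair_pre_digraph \<Rightarrow> enat" where
  "inv_eq p D = Inf {enat (length Xs) | Xs.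
     (\<forall>X \<in> set Xs. X \<subseteq> pverts D \<and> finite X \<and> card X = p) \<and>
     acyclic_digraph (fold inversion Xs D)}"

lemma oriented_graph_inversion:
  assumes "oriented_graph D"
  shows "oriented_graph (inversion X D)"
proof -
  interpret oriented_graph D by fact
  have sub: "parcs (inversion X D) \<subseteq> parcs D \<union> (parcs D)\<inverse>"
    by (auto simp: inversion_def)
  have irr: "(u, u) \<notin> parcs D" for u
    using no_digons by blast
  show ?thesis
  proof
    show "finite (parcs (inversion X D))"
      using sub pair_finite_arcs by (meson finite_Un finite_converse finite_subset)
  qed (use sub pair_finite_verts irr no_digons wellformed' in
        \<open>auto simp: inversion_def\<close>)
qed

lemma (in pair_wf_digraph) acyclic_digraph_iff_acyclic:
  "acyclic_digraph G \<longleftrightarrow> acyclic (parcs G)"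
proof
  assume a: "acyclic_digraph G"
  show "acyclic (parcs G)"
  proof (rule acyclicI, intro allI notI)
    fix x assume "(x, x) \<in> (parcs G)\<^sup>+"
    then obtain p where "awalk x p x" "p \<noteq> []"
      using reachable1_awalk by auto
    then have "closed_w p" by (auto simp: closed_w_def)
    with a show False using closed_w_imp_cycle by (auto simp: acyclic_digraph_def)
  qed
next
  assume a: "acyclic (parcs G)"
  show "acyclic_digraph G"
    unfolding acyclic_digraph_def
  proof (intro notI, elim exE)
    fix c assume "cycle c"
    then obtain u where "awalk u c u" "c \<noteq> []" by (auto simp: cycle_def)
    then have "(u, u) \<in> (parcs G)\<^sup>+"
      using reachable1_awalk by auto
    with a show False by (auto simp: acyclic_def)
  qed
qed

end

theory Submission
  imports Defs
begin

text \<open>Vertices are turned into sources one after the other. Inverting \<open>{v} \<union> T\<close> with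
  \<open>card T = p - 1\<close> fixes \<open>p - 1\<close> arcs at \<open>v\<close>, and what it does to the remaining vertices is
  irrelevant; fewer than \<open>p - 1\<close> in-arcs are then left at \<open>v\<close>. Each of these is reversed with
  \<open>p - 1\<close> inversions, using that \<open>p - 1\<close> is odd and \<open>p - 2\<close> even. Once only \<open>p + 2\<close>
  vertices remain, every set of pairs of even size can be reversed exactly by at most
  \<open>(p + 2)\<^sup>2\<close> inversions of complements of pairs.\<close>

section \<open>Lists of inversions described by parities of pairs\<close>

definition flips :: "'a set list \<Rightarrow> 'a \<Rightarrow> 'a \<Rightarrow> bool" where
  "flips Xs x y \<longleftrightarrow> odd (length (filter (\<lambda>X. x \<in> X \<and> y \<in> X) Xs))"

text \<open>Reversing a pair twice restores it, so a list of inversions acts on each pair only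
  through the parity \<open>flips\<close>. This closed form replaces the fold over digraphs and
  makes the order of the list irrelevant.\<close>

definition invert_arcs :: "'a set list \<Rightarrow> ('a \<times> 'a) set \<Rightarrow> ('a \<times> 'a) set" where
  "invert_arcs Xs A = {(x, y). if flips Xs x y then (y, x) \<in> A else (x, y) \<in> A}"

lemma flips_Nil [simp]: "\<not> flips [] x y"
  by (simp add: flips_def)

lemma flips_append: "flips (Xs @ Ys) x y \<longleftrightarrow> flips Xs x y \<noteq> flips Ys x y"
  by (auto simp: flips_def)

lemma flips_Cons: "flips (X # Xs) x y \<longleftrightarrow> (x \<in> X \<and> y \<in> X) \<noteq> flips Xs x y"
  by (auto simp: flips_def)

lemma flips_commute: "flips Xs x y \<longleftrightarrow> flips Xs y x"
  by (simp add: flips_def conj_commute)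

text \<open>Used to freeze the arcs at a vertex that is already a source: all later inversions avoid
  it.\<close>

lemma not_flips_outside:
  assumes "\<And>X. X \<in> set Xs \<Longrightarrow> x \<notin> X"
  shows "\<not> flips Xs x y"
  using assms by (induction Xs) (auto simp: flips_Cons)

lemma flips_map_distinct:
  assumes "distinct xs"
  shows "flips (map f xs) x y \<longleftrightarrow> odd (card {a \<in> set xs. x \<in> f a \<and> y \<in> f a})"
proof -
  have "length (filter (\<lambda>X. x \<in> X \<and> y \<in> X) (map f xs))
      = length (filter (\<lambda>a. x \<in> f a \<and> y \<in> f a) xs)"
    by (simp add: filter_map o_def)
  also have "\<dots> = card ({a. x \<in> f a \<and> y \<in> f a} \<inter> set xs)"
    using assms by (rule distinct_length_filter)
  also have "{a. x \<in> f a \<and> y \<in> f a} \<inter> set xs = {a \<in> set xs. x \<in> f a \<and> y \<in> f a}"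
    by auto
  finally show ?thesis by (simp add: flips_def)
qed

lemma invert_arcs_append: "invert_arcs (Xs @ Ys) A = invert_arcs Ys (invert_arcs Xs A)"
  by (auto simp: invert_arcs_def flips_append flips_commute split: if_splits)

lemma parcs_fold_inversion: "parcs (fold inversion Xs D) = invert_arcs Xs (parcs D)"
proof (induction Xs arbitrary: D)
  case Nil
  then show ?case by (simp add: invert_arcs_def)
next
  case (Cons X Xs)
  have "parcs (inversion X D) = invert_arcs [X] (parcs D)"
    by (auto simp: inversion_def invert_arcs_def flips_Cons)
  then show ?case
    using Cons invert_arcs_append[of "[X]" Xs "parcs D"] by simp
qed

lemma oriented_graph_fold_inversion:
  "oriented_graph D \<Longrightarrow> oriented_graph (fold inversion Xs D)"
  by (induction Xs arbitrary: D) (auto simp: oriented_graph_inversion)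

section \<open>Reversing prescribed arcs at one vertex\<close>

text \<open>Take a set \<open>W\<close> of \<open>p - 1\<close> vertices other than \<open>u\<close>
  and \<open>v\<close>, and invert \<open>{v, u} \<union> W - {w}\<close> for each
  \<open>w \<in> W\<close>. Then \<open>v\<close> meets \<open>u\<close> in all \<open>p - 1\<close>
  sets, an odd number, and each element of \<open>W\<close> in \<open>p - 2\<close> of them, an even
  number. Pairs inside \<open>R\<close> are not controlled.\<close>

lemma flip_single_edge:
  fixes R :: "'a set"
  assumes "finite R" "p \<le> card R" "v \<notin> R" "u \<in> R" "p \<ge> 2" "even p"
  obtains Ys where "\<And>X. X \<in> set Ys \<Longrightarrow> X \<subseteq> insert v R \<and> card X = p"
    and "length Ys = p - 1" and "\<And>x. x \<in> R \<Longrightarrow> flips Ys v x \<longleftrightarrow> x = u"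
proof -
  have "p - 1 \<le> card (R - {u})" using assms by simp
  then obtain W where W: "W \<subseteq> R - {u}" "card W = p - 1" "finite W"
    using obtain_subset_with_card_n by metis
  obtain xs where xs: "distinct xs" "set xs = W"
    using finite_distinct_list[OF W(3)] by blast
  define Ys where "Ys = map (\<lambda>w. insert v (insert u W - {w})) xs"
  have "X \<subseteq> insert v R \<and> card X = p" if X: "X \<in> set Ys" for X
  proof -
    obtain w where w: "w \<in> W" "X = insert v (insert u W - {w})"
      using X xs by (auto simp: Ys_def)
    have "card (insert u W) = p" using W assms by (auto simp: card_insert_if)
    then have "card (insert u W - {w}) = p - 1" using w W by simp
    moreover have "v \<notin> insert u W - {w}" using assms W by auto
    ultimately show ?thesis using w W assms by (auto simp: card_insert_if)
  qed
  moreover have "length Ys = p - 1"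
    using W xs by (simp add: Ys_def flip: distinct_card)
  moreover have "flips Ys v x \<longleftrightarrow> x = u" if "x \<in> R" for x
  proof -
    have eq: "flips Ys v x \<longleftrightarrow> odd (card {w \<in> W. x \<in> insert u W - {w}})"
      unfolding Ys_def flips_map_distinct[OF xs(1)] xs(2)
      using that assms by (intro arg_cong[where f = "\<lambda>A. odd (card A)"]) auto
    consider "x = u" | "x \<in> W" "x \<noteq> u" | "x \<notin> insert u W" by auto
    then show ?thesis
    proof cases
      case 1
      then have "{w \<in> W. x \<in> insert u W - {w}} = W" using W by auto
      then show ?thesis using eq 1 W assms by auto
    next
      case 2
      then have "{w \<in> W. x \<in> insert u W - {w}} = W - {x}" by auto
      then have "card {w \<in> W. x \<in> insert u W - {w}} = p - 2" using 2 W by simp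
      then show ?thesis using eq 2 assms by auto
    next
      case 3
      then show ?thesis using eq by auto
    qed
  qed
  ultimately show ?thesis using that by blast
qed

text \<open>Parities at \<open>v\<close> add up, so the elements of \<open>S\<close> can be treated
  one by one. At \<open>p - 1\<close> inversions per arc this is affordable only for a small
  remainder.\<close>

lemma flip_star_singly:
  fixes R :: "'a set"
  assumes "finite R" "p \<le> card R" "v \<notin> R" "p \<ge> 2" "even p" "S \<subseteq> R"
  shows "\<exists>Ys. (\<forall>X \<in> set Ys. X \<subseteq> insert v R \<and> card X = p)
    \<and> length Ys = card S * (p - 1) \<and> (\<forall>x \<in> R. flips Ys v x \<longleftrightarrow> x \<in> S)"
proof -
  have "finite S" using assms finite_subset by blast
  then show ?thesis using assms(6)
  proof (induction S)
    case empty
    then show ?case by (intro exI[of _ "[]"]) simp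
  next
    case (insert u S)
    then obtain Ys where Ys: "\<forall>X \<in> set Ys. X \<subseteq> insert v R \<and> card X = p"
      "length Ys = card S * (p - 1)" "\<forall>x \<in> R. flips Ys v x \<longleftrightarrow> x \<in> S" by auto
    obtain Zs where Zs: "\<And>X. X \<in> set Zs \<Longrightarrow> X \<subseteq> insert v R \<and> card X = p"
      "length Zs = p - 1" "\<And>x. x \<in> R \<Longrightarrow> flips Zs v x \<longleftrightarrow> x = u"
      using flip_single_edge[OF assms(1-3) _ assms(4,5)] insert.prems by blast
    have "\<forall>X \<in> set (Ys @ Zs). X \<subseteq> insert v R \<and> card X = p"
      using Ys(1) Zs(1) by (metis Un_iff set_append)
    moreover have "length (Ys @ Zs) = card (insert u S) * (p - 1)"
      using Ys(2) Zs(2) insert.hyps by simp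
    moreover have "\<forall>x \<in> R. flips (Ys @ Zs) v x \<longleftrightarrow> x \<in> insert u S"
      using Ys(3) Zs(3) insert.hyps by (auto simp: flips_append)
    ultimately show ?case by blast
  qed
qed

text \<open>Greedy: while \<open>S\<close> has at least \<open>p - 1\<close> elements, one inversion
  disposes of \<open>p - 1\<close> of them. The fewer than \<open>p - 1\<close> left over are
  treated singly, which costs the additive \<open>p\<close> squared.\<close>

lemma flip_star:
  fixes R :: "'a set"
  assumes "finite R" "p \<le> card R" "v \<notin> R" "p \<ge> 2" "even p" "S \<subseteq> R"
  shows "\<exists>Ys. (\<forall>X \<in> set Ys. X \<subseteq> insert v R \<and> card X = p)
    \<and> real (length Ys) \<le> card S / (real p - 1) + (real p)\<^sup>2
    \<and> (\<forall>x \<in> R. flips Ys v x \<longleftrightarrow> x \<in> S)"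
  using assms(6)
proof (induction "card S" arbitrary: S rule: less_induct)
  case less
  have finS: "finite S" using less.prems assms finite_subset by blast
  show ?case
  proof (cases "card S < p - 1")
    case True
    obtain Ys where Ys: "\<forall>X \<in> set Ys. X \<subseteq> insert v R \<and> card X = p"
      "length Ys = card S * (p - 1)" "\<forall>x \<in> R. flips Ys v x \<longleftrightarrow> x \<in> S"
      using flip_star_singly[OF assms(1-5) less.prems] by blast
    have "length Ys \<le> p * p" unfolding Ys(2) by (rule mult_le_mono) (use True in auto)
    then have "real (length Ys) \<le> (real p)\<^sup>2"
      by (metis of_nat_le_iff of_nat_mult power2_eq_square)
    moreover have "0 \<le> card S / (real p - 1)" using assms by simp
    ultimately show ?thesis using Ys by (intro exI[of _ Ys]) auto
  next
    case False
    then obtain T where T: "T \<subseteq> S" "card T = p - 1" "finite T"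
      using obtain_subset_with_card_n[of "p - 1" S] by auto
    have c: "card (S - T) = card S - (p - 1)" using T by (simp add: card_Diff_subset)
    then have "card (S - T) < card S" using False assms by simp
    then obtain Ys where Ys: "\<forall>X \<in> set Ys. X \<subseteq> insert v R \<and> card X = p"
      "real (length Ys) \<le> card (S - T) / (real p - 1) + (real p)\<^sup>2"
      "\<forall>x \<in> R. flips Ys v x \<longleftrightarrow> x \<in> S - T"
      using less by blast
    have "real (card (S - T)) = card S - (real p - 1)"
      using c False assms by (simp add: of_nat_diff)
    then have "card (S - T) / (real p - 1) + 1 = card S / (real p - 1)"
      using assms by (simp add: field_simps)
    then have "real (length (insert v T # Ys)) \<le> card S / (real p - 1) + (real p)\<^sup>2"
      using Ys(2) by simp
    moreover have "card (insert v T) = p" "insert v T \<subseteq> insert v R"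
      using T less.prems assms by (auto simp: card_insert_if)
    \<comment> \<open>Among the pairs at \<open>v\<close>, the set \<open>insert v T\<close>
      reverses just those to \<open>T\<close>, and \<open>Ys\<close> those to
      \<open>S - T\<close>.\<close>
    moreover have "\<forall>x \<in> R. flips (insert v T # Ys) v x \<longleftrightarrow> x \<in> S"
      using Ys(3) T assms by (auto simp: flips_Cons)
    ultimately show ?thesis using Ys(1) by (intro exI[of _ "insert v T # Ys"]) auto
  qed
qed

section \<open>Parity counts for graphs given as sets of doubletons\<close>

lemma even_card_sym_diff:
  assumes "finite A" "finite B"
  shows "even (card (sym_diff A B)) \<longleftrightarrow> even (card A) = even (card B)"
proof -
  have "card A = card (A - B) + card (A \<inter> B)" "card B = card (B - A) + card (A \<inter> B)"
    using assms card_Int_Diff[of A B] card_Int_Diff[of B A] by (simp_all add: Int_commute)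
  moreover have "card (sym_diff A B) = card (A - B) + card (B - A)"
    using assms by (intro card_Un_disjoint) auto
  ultimately show ?thesis by auto
qed

text \<open>Handshake argument: each edge has two ends, so the degrees have an even sum.\<close>

lemma even_card_odd_degree:
  assumes "finite V" "finite H" "\<And>e. e \<in> H \<Longrightarrow> e \<subseteq> V \<and> card e = 2"
  shows "even (card {x \<in> V. odd (card {e \<in> H. x \<in> e})})"
proof -
  have "(\<Sum>x\<in>V. card {e \<in> H. x \<in> e}) = (\<Sum>e\<in>H. card {x \<in> V. x \<in> e})"
    using assms by (intro sum_multicount_gen) auto
  also have "\<dots> = (\<Sum>e\<in>H. 2)"
  proof (rule sum.cong)
    fix e assume "e \<in> H"
    then have "{x \<in> V. x \<in> e} = e" "card e = 2" using assms by auto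
    then show "card {x \<in> V. x \<in> e} = 2" by simp
  qed simp
  finally have "even (\<Sum>x\<in>V. card {e \<in> H. x \<in> e})" by simp
  then show ?thesis using assms by (simp add: even_sum_iff)
qed

text \<open>Inclusion-exclusion modulo 2: the avoiding edges are the sum of \<open>F\<close>, the
  edges at \<open>x\<close>, the edges at \<open>y\<close> and the edges at both. The first has even
  size, and the last is \<open>{{x, y}}\<close> or empty.\<close>

lemma odd_card_avoiding:
  assumes "finite F" "x \<noteq> y" "even (card F)" "\<And>e. e \<in> F \<Longrightarrow> card e = 2"
  shows "odd (card {e \<in> F. x \<notin> e \<and> y \<notin> e}) \<longleftrightarrow>
    ((odd (card {e \<in> F. x \<in> e}) \<noteq> odd (card {e \<in> F. y \<in> e})) \<noteq> ({x, y} \<in> F))"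
proof -
  let ?X = "{e \<in> F. x \<in> e}" and ?Y = "{e \<in> F. y \<in> e}"
  have xy: "{e \<in> F. x \<in> e \<and> y \<in> e} = (if {x, y} \<in> F then {{x, y}} else {})"
  proof -
    have "e = {x, y}" if "e \<in> F" "x \<in> e" "y \<in> e" for e
    proof -
      have "card e = 2" using that assms by blast
      then show ?thesis using that assms(2) by (auto simp: card_2_iff)
    qed
    then have "{e \<in> F. x \<in> e \<and> y \<in> e} = {e \<in> F. e = {x, y}}" by blast
    then show ?thesis by (auto simp only: Collect_conv_if2 split: if_splits)
  qed
  have fin: "finite F" "finite {e \<in> F. P e}" for P using assms(1) by auto
  have "{e \<in> F. x \<notin> e \<and> y \<notin> e}
      = sym_diff F (sym_diff (sym_diff ?X ?Y) {e \<in> F. x \<in> e \<and> y \<in> e})"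
    by auto
  then have "even (card {e \<in> F. x \<notin> e \<and> y \<notin> e}) \<longleftrightarrow>
      (even (card ?X) = even (card ?Y)) = even (card {e \<in> F. x \<in> e \<and> y \<in> e})"
    using assms(3) by (simp only: even_card_sym_diff finite_Un finite_Diff fin simp_thms)
  then show ?thesis unfolding xy by auto
qed

section \<open>Cuts, and the base case of \<open>p + 2\<close> vertices\<close>

text \<open>For disjoint \<open>A\<close> and \<open>B\<close> this is the edge set of the complete
  bipartite graph; it serves as the cut between \<open>Od\<close> and its complement.\<close>

definition edges_between :: "'a set \<Rightarrow> 'a set \<Rightarrow> 'a set set" where
  "edges_between A B = (\<lambda>(x, y). {x, y}) ` (A \<times> B)"

lemma card_edges_between:
  assumes "A \<inter> B = {}"
  shows "card (edges_between A B) = card A * card B"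
proof -
  have "inj_on (\<lambda>(x, y). {x, y}) (A \<times> B)"
    using assms by (auto simp: inj_on_def doubleton_eq_iff)
  then show ?thesis by (simp add: edges_between_def card_image card_cartesian_product)
qed

lemma card_edges_between_incident:
  assumes "A \<inter> B = {}" "x \<in> A"
  shows "card {e \<in> edges_between A B. x \<in> e} = card B"
proof -
  have "{e \<in> edges_between A B. x \<in> e} = edges_between {x} B"
    using assms by (auto simp: edges_between_def)
  moreover have "{x} \<inter> B = {}" using assms by auto
  ultimately show ?thesis using card_edges_between[of "{x}" B] by simp
qed

lemma edges_between_commute: "edges_between A B = edges_between B A"
proof -
  have "edges_between A B \<subseteq> edges_between B A" for A B :: "'a set"
    by (force simp: edges_between_def image_iff)
  then show ?thesis by blast
qed

text \<open>Let \<open>S x\<close> be the full star at \<open>x\<close>. Inverting \<open>V - {x, y}\<close> adds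
  \<open>K + S x + S y + {x, y}\<close> modulo 2, where \<open>K\<close> is the complete graph, so doing this for all
  edges of a graph \<open>F\<close> with an even number of edges adds \<open>F\<close> plus the cut around the odd-degree
  vertices of \<open>F\<close>. As \<open>card V\<close> is even, the correction \<open>H \<mapsto> H + cut\<close> preserves all
  degree parities, so the two cuts cancel.\<close>

lemma flip_even_edge_set:
  assumes "finite V" "card V = p + 2" "even p"
    and H: "\<And>e. e \<in> H \<Longrightarrow> e \<subseteq> V \<and> card e = 2" "even (card H)"
  obtains Xs where "\<And>X. X \<in> set Xs \<Longrightarrow> X \<subseteq> V \<and> card X = p"
    and "length Xs \<le> (p + 2)\<^sup>2"
    and "\<And>x y. x \<in> V \<Longrightarrow> y \<in> V \<Longrightarrow> x \<noteq> y \<Longrightarrow> flips Xs x y \<longleftrightarrow> {x, y} \<in> H"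
proof -
  have finH: "finite H"
    using assms(1) H(1) by (intro finite_subset[of H "Pow V"]) auto
  define Od where "Od = {x \<in> V. odd (card {e \<in> H. x \<in> e})}"
  define C where "C = edges_between Od (V - Od)"
  define F where "F = sym_diff H C"
  have OdV: "Od \<subseteq> V" by (auto simp: Od_def)
  have finO: "finite Od" using OdV assms(1) finite_subset by blast
  have evO: "even (card Od)"
    unfolding Od_def using even_card_odd_degree[OF assms(1) finH] H(1) by blast
  have evO': "even (card (V - Od))"
    using evO assms OdV finO by (simp add: card_Diff_subset)
  have C: "e \<subseteq> V \<and> card e = 2" if "e \<in> C" for e
    using that OdV by (auto simp: C_def edges_between_def card_2_iff)
  have finC: "finite C" using finO assms(1) by (simp add: C_def edges_between_def)
  have F: "e \<subseteq> V \<and> card e = 2" if "e \<in> F" for e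
    using that C H(1) by (auto simp: F_def)
  have finF: "finite F" using finC finH by (simp add: F_def)
  \<comment> \<open>The cut has even size because \<open>card Od\<close> is even, so
    \<open>F\<close> inherits from \<open>H\<close> the even size that
    \<open>odd_card_avoiding\<close> requires.\<close>
  have "card C = card Od * card (V - Od)" unfolding C_def by (rule card_edges_between) auto
  then have evF: "even (card F)"
    unfolding F_def using evO H(2) by (simp add: even_card_sym_diff finH finC)
  have degF: "odd (card {e \<in> F. x \<in> e}) \<longleftrightarrow> x \<in> Od" if "x \<in> V" for x
  proof -
    have "even (card {e \<in> C. x \<in> e})"
    proof (cases "x \<in> Od")
      case True
      then show ?thesis unfolding C_def using evO' by (subst card_edges_between_incident) auto
    next
      case False
      then show ?thesis unfolding C_def edges_between_commute[of Od] using evO that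
        by (subst card_edges_between_incident) auto
    qed
    moreover have "{e \<in> F. x \<in> e} = sym_diff {e \<in> H. x \<in> e} {e \<in> C. x \<in> e}"
      by (auto simp: F_def)
    ultimately show ?thesis
      using that finH finC by (simp add: even_card_sym_diff) (simp add: Od_def)
  qed
  obtain es where es: "distinct es" "set es = F" using finite_distinct_list[OF finF] by blast
  define Xs where "Xs = map (\<lambda>e. V - e) es"
  have "X \<subseteq> V \<and> card X = p" if X: "X \<in> set Xs" for X
  proof -
    obtain e where e: "e \<in> F" "X = V - e" using X es by (auto simp: Xs_def)
    then show ?thesis using F[OF e(1)] assms(1,2)
      by (auto simp: card_Diff_subset finite_subset)
  qed
  moreover have "length Xs \<le> (p + 2)\<^sup>2"
  proof -
    have "F \<subseteq> (\<lambda>(x, y). {x, y}) ` (V \<times> V)"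
      using F by (fastforce simp: card_2_iff)
    then have "card F \<le> card (V \<times> V)"
      using assms(1) by (meson card_image_le card_mono finite_SigmaI finite_imageI le_trans)
    then show ?thesis
      using es assms by (simp add: Xs_def card_cartesian_product power2_eq_square
          flip: distinct_card)
  qed
  moreover have "flips Xs x y \<longleftrightarrow> {x, y} \<in> H" if "x \<in> V" "y \<in> V" "x \<noteq> y" for x y
  proof -
    have "flips Xs x y \<longleftrightarrow> odd (card {e \<in> F. x \<notin> e \<and> y \<notin> e})"
      unfolding Xs_def using that by (simp add: flips_map_distinct es)
    also have "\<dots> \<longleftrightarrow> ((x \<in> Od) \<noteq> (y \<in> Od)) \<noteq> ({x, y} \<in> F)"
      using odd_card_avoiding[OF finF that(3) evF] F degF that by blast
    also have "{x, y} \<in> C \<longleftrightarrow> (x \<in> Od) \<noteq> (y \<in> Od)"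
      using that by (auto simp: C_def edges_between_def doubleton_eq_iff image_iff)
    then have "(((x \<in> Od) \<noteq> (y \<in> Od)) \<noteq> ({x, y} \<in> F)) \<longleftrightarrow> {x, y} \<in> H"
      by (auto simp: F_def)
    finally show ?thesis .
  qed
  ultimately show ?thesis using that by blast
qed

text \<open>The number of backward arcs can be made even because exchanging the first two vertices
  of the order changes its parity; if these vertices are not adjacent, flipping the pair is
  harmless instead.\<close>

lemma invert_arcs_base:
  assumes "finite V" "card V = p + 2" "even p"
    and A: "A \<subseteq> V \<times> V" "\<And>x y. (x, y) \<in> A \<Longrightarrow> (y, x) \<notin> A"
  shows "\<exists>Xs f. (\<forall>X \<in> set Xs. X \<subseteq> V \<and> card X = p) \<and> length Xs \<le> (p + 2)\<^sup>2
    \<and> (\<forall>(x, y) \<in> invert_arcs Xs A. f x < (f y :: nat))"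
proof -
  obtain f where f: "bij_betw f V {0..<p + 2}"
    using ex_bij_betw_finite_nat[OF assms(1)] assms(2) by auto
  then have inj: "f x = f y \<longleftrightarrow> x = y" if "x \<in> V" "y \<in> V" for x y
    using that by (auto simp: bij_betw_def inj_on_eq_iff)
  have img: "f ` V = {0..<p + 2}" using f by (simp add: bij_betw_def)
  have "0 \<in> f ` V" "1 \<in> f ` V" unfolding img by auto
  then obtain a b where ab: "a \<in> V" "f a = 0" "b \<in> V" "f b = 1" by fastforce
  then have "a \<noteq> b" by auto
  have irr: "x \<noteq> y" if "(x, y) \<in> A" for x y using A(2) that by blast
  define H0 where "H0 = {{x, y} | x y. (x, y) \<in> A \<and> f y < f x}"
  have H0: "e \<subseteq> V \<and> card e = 2" if e: "e \<in> H0" for e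
  proof -
    obtain x y where "e = {x, y}" "(x, y) \<in> A" using e unfolding H0_def by blast
    then show ?thesis using A(1) irr[of x y] by auto
  qed
  have finH0: "finite H0"
    using assms(1) H0 by (intro finite_subset[of H0 "Pow V"]) auto
  have mem: "{x, y} \<in> H0 \<longleftrightarrow> f y < f x" if "(x, y) \<in> A" for x y
    using that A(2) by (auto simp: H0_def doubleton_eq_iff)
  define H where "H = (if even (card H0) then H0 else sym_diff H0 {{a, b}})"
  define g where "g = (if even (card H0) then f else f(a := 1, b := 0))"
  have "e \<subseteq> V \<and> card e = 2" if "e \<in> H" for e
    using that H0 ab \<open>a \<noteq> b\<close> by (auto simp: H_def split: if_splits)
  moreover have "even (card H)"
    using finH0 even_card_sym_diff[of H0 "{{a, b}}"] by (simp add: H_def)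
  ultimately obtain Xs where Xs: "\<And>X. X \<in> set Xs \<Longrightarrow> X \<subseteq> V \<and> card X = p"
      "length Xs \<le> (p + 2)\<^sup>2"
      "\<And>x y. x \<in> V \<Longrightarrow> y \<in> V \<Longrightarrow> x \<noteq> y \<Longrightarrow> flips Xs x y \<longleftrightarrow> {x, y} \<in> H"
    using flip_even_edge_set[OF assms(1-3)] by blast
  \<comment> \<open>The order \<open>g\<close> reverses \<open>f\<close> on exactly the pairs where
    \<open>H\<close> and \<open>H0\<close> differ: none, or \<open>{a, b}\<close> alone.\<close>
  have g: "g x < g y \<longleftrightarrow> (f x < f y) = ({x, y} \<in> H \<longleftrightarrow> {x, y} \<in> H0)"
    if "x \<in> V" "y \<in> V" "x \<noteq> y" for x y
  proof (cases "even (card H0)")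
    case True
    then show ?thesis by (simp add: g_def H_def)
  next
    case False
    have "({x, y} \<in> H \<longleftrightarrow> {x, y} \<in> H0) \<longleftrightarrow> {x, y} \<noteq> {a, b}"
      using False by (auto simp: H_def)
    \<comment> \<open>As \<open>a\<close> and \<open>b\<close> hold the ranks 0 and 1, every other
      vertex ranks above both, and exchanging them affects no comparison with it.\<close>
    moreover have "f z > 1" if "z \<in> V" "z \<noteq> a" "z \<noteq> b" for z
      using inj[OF that(1) ab(1)] inj[OF that(1) ab(3)] that ab by linarith
    from this[of x] this[of y] have "x = a \<or> x = b \<or> f x > 1" "y = a \<or> y = b \<or> f y > 1"
      using that by blast+
    ultimately show ?thesis
      using False that(3) ab(2,4) \<open>a \<noteq> b\<close>
      by (elim disjE) (auto simp: g_def doubleton_eq_iff)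
  qed
  have "g x < g y" if "(x, y) \<in> invert_arcs Xs A" for x y
  proof -
    have V: "x \<in> V" "y \<in> V" "x \<noteq> y"
      using that A(1) irr by (auto simp: invert_arcs_def split: if_splits)
    have fl: "flips Xs x y \<longleftrightarrow> {x, y} \<in> H" using Xs(3) V by blast
    have ne: "f x \<noteq> f y" using inj V by blast
    show ?thesis
    proof (cases "flips Xs x y")
      case True
      then have "(y, x) \<in> A" using that by (simp add: invert_arcs_def)
      from mem[OF this] have "{x, y} \<in> H0 \<longleftrightarrow> f x < f y" by (simp add: insert_commute)
      then show ?thesis using g[OF V] fl True by blast
    next
      case False
      then have "(x, y) \<in> A" using that by (simp add: invert_arcs_def)
      from mem[OF this] have "{x, y} \<in> H0 \<longleftrightarrow> \<not> f x < f y" using ne by auto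
      then show ?thesis using g[OF V] fl False by blast
    qed
  qed
  then show ?thesis using Xs(1,2) by blast
qed

section \<open>Induction on the number of vertices\<close>

text \<open>One vertex is made a source and the rest is handled by induction. The rank
  \<open>f\<close> certifies acyclicity and is easily extended by a new minimum.
  \<open>A \<union> A\<inverse>\<close> counts each adjacent pair twice and is invariant under
  inversion, so the uncontrolled reversals elsewhere do not affect the bound.\<close>

lemma invert_arcs_increasing:
  assumes "p \<ge> 4" "even p" "finite V" "card V \<ge> p + 2"
    and "A \<subseteq> V \<times> V" "\<And>x y. (x, y) \<in> A \<Longrightarrow> (y, x) \<notin> A"
  shows "\<exists>Xs f. (\<forall>X \<in> set Xs. X \<subseteq> V \<and> card X = p)
    \<and> real (length Xs) \<le> card (A \<union> A\<inverse>) / (2 * (real p - 1)) + 2 * (real p)\<^sup>2 * card V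
    \<and> (\<forall>(x, y) \<in> invert_arcs Xs A. f x < (f y :: nat))"
  using assms(3-)
proof (induction "card V" arbitrary: V A)
  case 0
  then show ?case by simp
next
  case (Suc n)
  show ?case
  proof (cases "Suc n = p + 2")
    case True
    obtain Xs f where Xs: "\<forall>X \<in> set Xs. X \<subseteq> V \<and> card X = p" "length Xs \<le> (p + 2)\<^sup>2"
      "\<forall>(x, y) \<in> invert_arcs Xs A. f x < (f y :: nat)"
      using invert_arcs_base[of V p A] Suc True assms by auto
    \<comment> \<open>The vertex term alone pays for the base case; the arc term is only needed to
      be nonnegative.\<close>
    have "p + 2 \<le> 2 * p" using assms(1) by simp
    also have "\<dots> \<le> 2 * p\<^sup>2" by (simp add: power2_eq_square)
    finally have "(p + 2)\<^sup>2 \<le> 2 * p\<^sup>2 * (p + 2)"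
      unfolding power2_eq_square[of "p + 2"] by (rule mult_le_mono1)
    with Xs(2) have "length Xs \<le> 2 * p\<^sup>2 * (p + 2)" by (rule order_trans)
    then have "real (length Xs) \<le> real (2 * p\<^sup>2 * (p + 2))" by (rule of_nat_mono)
    moreover have "0 \<le> card (A \<union> A\<inverse>) / (2 * (real p - 1))" using assms(1) by simp
    ultimately have "real (length Xs) \<le> card (A \<union> A\<inverse>) / (2 * (real p - 1)) + 2 * (real p)\<^sup>2 * card V"
      using True Suc(2) by (simp add: algebra_simps)
    then show ?thesis using Xs by blast
  next
    case False
    then have n: "n \<ge> p + 2" using Suc by simp
    obtain v where v: "v \<in> V" using Suc(2) by (metis card.empty ex_in_conv nat.simps(3))
    define R where "R = V - {v}"
    have R: "finite R" "card R = n" "v \<notin> R" "V = insert v R"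
      using Suc v by (auto simp: R_def)
    \<comment> \<open>The in-neighbours of \<open>v\<close>: reversing exactly these arcs at
      \<open>v\<close> makes it a source.\<close>
    define S where "S = {x \<in> R. (x, v) \<in> A}"
    have "S \<subseteq> R" by (auto simp: S_def)
    then obtain Ys where Ys: "\<forall>X \<in> set Ys. X \<subseteq> insert v R \<and> card X = p"
      "real (length Ys) \<le> card S / (real p - 1) + (real p)\<^sup>2"
      "\<forall>x \<in> R. flips Ys v x \<longleftrightarrow> x \<in> S"
      using flip_star[OF R(1) _ R(3), of p S] n R assms by auto
    define B where "B = invert_arcs Ys A"
    \<comment> \<open>\<open>Ys\<close> may have reversed arcs inside \<open>R\<close> arbitrarily;
      the induction needs only that no digon arises.\<close>
    define A' where "A' = B \<inter> R \<times> R"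
    have B_orient: "(y, x) \<notin> B" if "(x, y) \<in> B" for x y
      using that Suc.prems(4)
      by (auto simp: B_def invert_arcs_def flips_commute[of _ x y] split: if_splits)
    then obtain Zs f where Zs: "\<forall>X \<in> set Zs. X \<subseteq> R \<and> card X = p"
      "real (length Zs) \<le> card (A' \<union> A'\<inverse>) / (2 * (real p - 1)) + 2 * (real p)\<^sup>2 * card R"
      "\<forall>(x, y) \<in> invert_arcs Zs A'. f x < (f y :: nat)"
      using Suc(1)[of R A'] R n by (auto simp: A'_def)
    have len: "real (length (Ys @ Zs))
      \<le> card (A \<union> A\<inverse>) / (2 * (real p - 1)) + 2 * (real p)\<^sup>2 * card V"
    proof -
      have fin: "finite (A \<union> A\<inverse>)"
        using Suc.prems by (meson finite_SigmaI finite_Un finite_converse finite_subset)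
      \<comment> \<open>Inversions preserve adjacency, so the pairs inside \<open>R\<close> and the
        pairs joining \<open>v\<close> to \<open>S\<close> were all adjacent in \<open>A\<close>.
        They are disjoint, and both are counted twice.\<close>
      have sub: "(A' \<union> A'\<inverse>) \<union> ({v} \<times> S \<union> S \<times> {v}) \<subseteq> A \<union> A\<inverse>"
        by (auto simp: A'_def B_def invert_arcs_def S_def split: if_splits)
      have finS: "finite S" using R \<open>S \<subseteq> R\<close> finite_subset by blast
      have "card (A' \<union> A'\<inverse>) + (card S + card S)
          = card (A' \<union> A'\<inverse>) + card ({v} \<times> S \<union> S \<times> {v})"
        using finS R \<open>S \<subseteq> R\<close>
        by (subst card_Un_disjoint) (auto simp: card_cartesian_product)
      also have "\<dots> = card ((A' \<union> A'\<inverse>) \<union> ({v} \<times> S \<union> S \<times> {v}))"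
        using finite_subset[OF sub fin] R
        by (intro card_Un_disjoint[symmetric]) (auto simp: A'_def)
      also have "\<dots> \<le> card (A \<union> A\<inverse>)" using sub fin by (rule card_mono[rotated])
      finally have "real (card (A' \<union> A'\<inverse>)) + 2 * card S \<le> card (A \<union> A\<inverse>)" by simp
      then have "(real (card (A' \<union> A'\<inverse>)) + 2 * card S) / (2 * (real p - 1))
          \<le> card (A \<union> A\<inverse>) / (2 * (real p - 1))"
        using assms(1) by (intro divide_right_mono) auto
      \<comment> \<open>The pairs at \<open>v\<close> pay for the first term in the bound on
        \<open>Ys\<close>. Its \<open>p\<close> squared fits into the
        \<open>2 * (real p)\<^sup>2\<close> by which the vertex term for \<open>V\<close> exceeds
        that for \<open>R\<close>.\<close>
      moreover have "(real (card (A' \<union> A'\<inverse>)) + 2 * card S) / (2 * (real p - 1))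
          = card (A' \<union> A'\<inverse>) / (2 * (real p - 1)) + card S / (real p - 1)"
        by (simp only: of_nat_mult of_nat_numeral add_divide_distrib
            mult_divide_mult_cancel_left_if) simp
      moreover have "2 * (real p)\<^sup>2 * card V = 2 * (real p)\<^sup>2 * card R + 2 * (real p)\<^sup>2"
        using R by (simp add: algebra_simps)
      ultimately show ?thesis using Ys(2) Zs(2) zero_le_power2[of "real p"]
        unfolding length_append of_nat_add by linarith
    qed
    have source: "y \<in> R \<and> (x = v \<or> (x, y) \<in> invert_arcs Zs A')"
      if xy: "(x, y) \<in> invert_arcs (Ys @ Zs) A" for x y
    proof -
      have inB: "(x, y) \<in> invert_arcs Zs B" using xy by (simp add: invert_arcs_append B_def)
      have B_sub: "B \<subseteq> V \<times> V"
        using Suc.prems by (auto simp: B_def invert_arcs_def split: if_splits)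
      \<comment> \<open>The sets in \<open>Zs\<close> lie in \<open>R\<close>, so \<open>v\<close>
        remains a source after \<open>Ys\<close> has made it one.\<close>
      have noZ: "\<not> flips Zs v z" "\<not> flips Zs z v" for z
        using Zs(1) R(3) not_flips_outside[of Zs v z] flips_commute[of Zs z v] by auto
      have noB: "(z, v) \<notin> B" for z
      proof
        assume z: "(z, v) \<in> B"
        have "z \<noteq> v" using B_orient[OF z] z by blast
        then have "z \<in> R" using z B_sub R by blast
        have fl: "flips Ys z v \<longleftrightarrow> (z, v) \<in> A"
          using Ys(3) \<open>z \<in> R\<close> flips_commute[of Ys z v] by (simp add: S_def)
        have "if flips Ys z v then (v, z) \<in> A else (z, v) \<in> A"
          using z by (simp add: B_def invert_arcs_def)
        then show False using fl Suc.prems(4)[of z v] by (simp split: if_splits)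
      qed
      have V: "x \<in> V" "y \<in> V" using inB B_sub by (auto simp: invert_arcs_def split: if_splits)
      have "y \<noteq> v" using inB noB noZ by (auto simp: invert_arcs_def)
      then have "y \<in> R" using V R by auto
      moreover have "(x, y) \<in> invert_arcs Zs A'" if "x \<noteq> v"
        using inB that V R \<open>y \<in> R\<close> by (auto simp: invert_arcs_def A'_def)
      ultimately show ?thesis by blast
    qed
    \<comment> \<open>Shifting the ranks on \<open>R\<close> by one leaves 0 free for the source
      \<open>v\<close>.\<close>
    define g where "g = (\<lambda>x. if x = v then 0 else Suc (f x))"
    have "\<forall>(x, y) \<in> invert_arcs (Ys @ Zs) A. g x < g y"
    proof clarify
      fix x y assume "(x, y) \<in> invert_arcs (Ys @ Zs) A"
      from source[OF this] show "g x < g y"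
        using R Zs(3) by (auto simp: g_def)
    qed
    moreover have "\<forall>X \<in> set (Ys @ Zs). X \<subseteq> V \<and> card X = p"
      using Ys(1) Zs(1) R by auto
    ultimately show ?thesis using len by blast
  qed
qed

theorem theorem1p10:
  fixes p n :: nat and D :: "'a pair_pre_digraph"
  assumes "p \<ge> 4" and "even p"
    and "oriented_graph D"
    and "card (pverts D) = n" and "n \<ge> p + 2"
  shows "ereal_of_enat (inv_eq p D)
    \<le> ereal (real (card (parcs D)) / (real p - 1) + 2 * (real p)\<^sup>2 * real n)"
proof -
  interpret oriented_graph D by fact
  let ?A = "parcs D"
  have "?A \<subseteq> pverts D \<times> pverts D" using wellformed' by auto
  then obtain Xs f where Xs: "\<forall>X \<in> set Xs. X \<subseteq> pverts D \<and> card X = p"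
    "real (length Xs) \<le> card (?A \<union> ?A\<inverse>) / (2 * (real p - 1)) + 2 * (real p)\<^sup>2 * card (pverts D)"
    "\<forall>(x, y) \<in> invert_arcs Xs ?A. f x < (f y :: nat)"
    using invert_arcs_increasing[of p "pverts D" ?A] assms no_digons by auto
  interpret E: oriented_graph "fold inversion Xs D"
    using assms(3) by (rule oriented_graph_fold_inversion)
  \<comment> \<open>A natural-number rank that grows along every arc excludes cycles.\<close>
  have "invert_arcs Xs ?A \<subseteq> measure f" using Xs(3) by auto
  then have "acyclic (parcs (fold inversion Xs D))"
    unfolding parcs_fold_inversion by (meson acyclic_subset wf_acyclic wf_measure)
  then have "acyclic_digraph (fold inversion Xs D)"
    by (simp add: E.acyclic_digraph_iff_acyclic)
  then have "inv_eq p D \<le> enat (length Xs)"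
    unfolding inv_eq_def using Xs(1) finite_subset[OF _ pair_finite_verts]
    by (intro Inf_lower CollectI exI[of _ Xs]) auto
  then have "ereal_of_enat (inv_eq p D) \<le> ereal_of_enat (enat (length Xs))"
    by (simp only: ereal_of_enat_le_iff)
  also have "\<dots> \<le> ereal (real (card ?A) / (real p - 1) + 2 * (real p)\<^sup>2 * real n)"
  proof -
    \<comment> \<open>Symmetrising at most doubles the arc count, which cancels the 2 in the
      denominator.\<close>
    have "card (?A \<union> ?A\<inverse>) \<le> 2 * card ?A"
      using card_Un_le[of ?A "?A\<inverse>"] by (simp add: card_inverse)
    then have "real (card (?A \<union> ?A\<inverse>)) \<le> 2 * real (card ?A)" by linarith
    then have "card (?A \<union> ?A\<inverse>) / (2 * (real p - 1)) \<le> 2 * real (card ?A) / (2 * (real p - 1))"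
      using assms(1) by (intro divide_right_mono) auto
    also have "\<dots> = real (card ?A) / (real p - 1)" using assms(1) by (simp add: field_simps)
    finally show ?thesis using Xs(2) assms(4) by simp
  qed
  finally show ?thesis .
qed

end
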